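(* Let $(A,\mu_1,\mu_2)$ be a compatible associative algebra and $N\ge1$ a natural number. An order $N$ deformation $(\mu_{1,t}^N=\sum_{i=0}^Nt^i\mu_{1,i},\ \mu_{2,t}^N=\sum_{i=0}^Nt^i\mu_{2,i})$ of $A$ is extensible if and only if the corresponding obstruction class $[Ob_{(\mu_{1,t}^N,\mu_{2,t}^N)}]\in H^3_c(A,A)$ is trivial.
   Context: All vector spaces are finite-dimensional over a field $\mathbb{K}$ of characteristic $0$. A compatible associative algebra is a triple $(A,\mu_1,\mu_2)$ of a vector space with two associative bilinear products, written $a\cdot_1 b$ and $a\cdot_2 b$, with $(a\cdot_1 b)\cdot_2 c+(a\cdot_2 b)\cdot_1 c=a\cdot_1(b\cdot_2 c)+a\cdot_2(b\cdot_1 c)$ for all $a,b,c$ (and similarly over a commutative ring). Let $C^n(A,A)=\mathrm{Hom}(A^{\otimes n},A)$ and $C^n_c(A,A)=C^n(A,A)^{\oplus n}$ for $n\ge1$. The Gerstenhaber bracket of $f\in C^{m+1}(A,A)$, $g\in C^{n+1}(A,A)$ is $[f,g]_G=f\diamond g-(-1)^{mn}g\diamond f$, where $(f\diamond g)(a_1,\ldots,a_{m+n+1})=\sum_{i=1}^{m+1}(-1)^{(i-1)n}f(a_1,\ldots,a_{i-1},g(a_i,\ldots,a_{i+n}),\ldots,a_{m+n+1})$. The bracket $[\![~,~]\!]:C^{m+1}_c(A,A)\times C^{n+1}_c(A,A)\to C^{m+n+1}_c(A,A)$ sends $((f_1,\ldots,f_{m+1}),(g_1,\ldots,g_{n+1}))$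 to the tuple with $i$-th entry $\sum_{q+r=i+1}[f_q,g_r]_G$ ($1\le q\le m+1$, $1\le r\le n+1$). The coboundary is $\delta_c(f_1,\ldots,f_n)=(-1)^{n-1}[\![(\mu_1,\mu_2),(f_1,\ldots,f_n)]\!]$ for $n\geq1$; equivalently $\delta_c(f_1,\ldots,f_n)=(\delta_1f_1,\ldots,\delta_1f_i+\delta_2f_{i-1},\ldots,\delta_2f_n)$ with $\delta_1,\delta_2$ the Hochschild coboundaries of $(A,\mu_1)$, $(A,\mu_2)$ with coefficients in themselves. $H^3_c(A,A)$ is the space of $3$-cocycles $\{x\in C^3_c(A,A):\delta_cx=0\}$ modulo $\delta_c(C^2_c(A,A))$. An order $N$ deformation of $A$ is a pair of polynomials $\mu_{1,t}^N=\sum_{i=0}^Nt^i\mu_{1,i}$, $\mu_{2,t}^N=\sum_{i=0}^Nt^i\mu_{2,i}$, with $\mu_{1,i},\mu_{2,i}$ bilinear maps on $A$, $\mu_{1,0}=\mu_1$, $\mu_{2,0}=\mu_2$, such that $(A[[t]]/(t^{N+1}),\mu_{1,t}^N,\mu_{2,t}^N)$ is a compatible associative algebra over $\mathbb{K}[[t]]/(t^{N+1})$. It is extensible if there exist bilinear maps $\mu_{1,N+1},\mu_{2,N+1}$ on $A$ such that $(\mu_{1,t}^N+t^{N+1}\mu_{1,N+1},\ \mu_{2,t}^N+t^{N+1}\mu_{2,N+1})$ is an order $N+1$ deformation. Its obstruction cochain is $Ob_{(\mu_{1,t}^N,\mu_{2,t}^N)}=-\frac12\sum_{i+j=N+1;\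 i,j\ge1}[\![(\mu_{1,i},\mu_{2,i}),(\mu_{1,j},\mu_{2,j})]\!]\in C^3_c(A,A)$, which is a $3$-cocycle; its class in $H^3_c(A,A)$ is the obstruction class. *)

theory Defs
  imports
    Complex_Main
    "HOL-Library.Function_Algebras"
    "HOL-Computational_Algebra.Formal_Power_Series"
    "HOL-Algebra.Module"
    "HOL-Algebra.Coset"
    "HOL-Algebra.Algebraic_Closure_Type"
begin

section \<open>Compatible associative algebras over a commutative ring\<close>

definition bilinear_product ::
    "('r, 'x) ring_scheme \<Rightarrow> ('r, 'm, 'y) module_scheme \<Rightarrow> ('m \<Rightarrow> 'm \<Rightarrow> 'm) \<Rightarrow> bool" where
  "bilinear_product R M b \<longleftrightarrow>
    (\<forall>x\<in>carrier M. \<forall>y\<in>carrier M. b x y \<in> carrier M) \<and>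
    (\<forall>x\<in>carrier M. \<forall>y\<in>carrier M. \<forall>z\<in>carrier M.
       b (x \<oplus>\<^bsub>M\<^esub> y) z = b x z \<oplus>\<^bsub>M\<^esub> b y z \<and>
       b z (x \<oplus>\<^bsub>M\<^esub> y) = b z x \<oplus>\<^bsub>M\<^esub> b z y) \<and>
    (\<forall>c\<in>carrier R. \<forall>x\<in>carrier M. \<forall>y\<in>carrier M.
       b (c \<odot>\<^bsub>M\<^esub> x) y = c \<odot>\<^bsub>M\<^esub> b x y \<and>
       b x (c \<odot>\<^bsub>M\<^esub> y) = c \<odot>\<^bsub>M\<^esub> b x y)"

definition compatible_assoc_algebra ::
    "('r, 'x) ring_scheme \<Rightarrow> ('r, 'm, 'y) module_scheme \<Rightarrow>
     ('m \<Rightarrow> 'm \<Rightarrow> 'm) \<Rightarrow> ('m \<Rightarrow> 'm \<Rightarrow> 'm) \<Rightarrow> bool" where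
  "compatible_assoc_algebra R M p1 p2 \<longleftrightarrow>
    Module.module R M \<and> bilinear_product R M p1 \<and> bilinear_product R M p2 \<and>
    (\<forall>a\<in>carrier M. \<forall>b\<in>carrier M. \<forall>c\<in>carrier M.
       p1 (p1 a b) c = p1 a (p1 b c) \<and>
       p2 (p2 a b) c = p2 a (p2 b c) \<and>
       p2 (p1 a b) c \<oplus>\<^bsub>M\<^esub> p1 (p2 a b) c = p1 a (p2 b c) \<oplus>\<^bsub>M\<^esub> p2 a (p1 b c))"

text \<open>
  A vector space given by a scalar multiplication on a type, as a module in the sense of
  HOL-Algebra over the ring \<open>ring_of_type_algebra\<close>. The module record extends the ring record;
  its fields \<open>mult\<close> and \<open>one\<close> play no role in a module and are left undefined.
\<close>

definition module_of_scale ::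
    "('k \<Rightarrow> 'a::ab_group_add \<Rightarrow> 'a) \<Rightarrow> ('k, 'a) module" where
  "module_of_scale scale =
    \<lparr>carrier = UNIV, monoid.mult = undefined, one = undefined,
     ring.zero = 0, add = (+), module.smult = scale\<rparr>"


section \<open>Multilinear cochains and the bracket\<close>

text \<open>
  An element of \<open>Hom(A\<^sup>\<otimes>\<^sup>n, A)\<close> is a function on lists that is linear in each of the
  entries of a list of length \<open>n\<close>; it is set to zero on lists of any other length, so that
  two cochains are equal iff they agree on \<open>A\<^sup>n\<close>.
\<close>

definition cochains ::
    "('k::field \<Rightarrow> 'a::ab_group_add \<Rightarrow> 'a) \<Rightarrow> nat \<Rightarrow> ('a list \<Rightarrow> 'a) set" where
  "cochains scale n =
    {f. (\<forall>xs k. length xs = n \<and> k < n \<longrightarrow>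
           Vector_Spaces.linear scale scale (\<lambda>x. f (xs[k := x]))) \<and>
        (\<forall>xs. length xs \<noteq> n \<longrightarrow> f xs = 0)}"

text \<open>
  An \<open>n\<close>-tuple of cochains \<open>(f\<^sub>1, \<dots>, f\<^sub>n)\<close> is a sequence indexed from 1 and vanishing at
  all indices outside \<open>{1..n}\<close>.
\<close>

definition compatible_cochains ::
    "('k::field \<Rightarrow> 'a::ab_group_add \<Rightarrow> 'a) \<Rightarrow> nat \<Rightarrow> (nat \<Rightarrow> 'a list \<Rightarrow> 'a) set" where
  "compatible_cochains scale n =
    {F. (\<forall>i\<in>{1..n}. F i \<in> cochains scale n) \<and> (\<forall>i. i \<notin> {1..n} \<longrightarrow> F i = 0)}"

text \<open>
  In the following definitions \<open>f\<close> has \<open>m + 1\<close> and \<open>g\<close> has \<open>n + 1\<close> arguments.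
\<close>

definition diamond ::
    "('k::field \<Rightarrow> 'a::ab_group_add \<Rightarrow> 'a) \<Rightarrow> nat \<Rightarrow> nat \<Rightarrow>
     ('a list \<Rightarrow> 'a) \<Rightarrow> ('a list \<Rightarrow> 'a) \<Rightarrow> ('a list \<Rightarrow> 'a)" where
  "diamond scale m n f g = (\<lambda>xs.
     if length xs = m + n + 1 then
       \<Sum>i = 1..m + 1. scale ((- 1) ^ ((i - 1) * n))
         (f (take (i - 1) xs @ [g (take (n + 1) (drop (i - 1) xs))] @ drop (i + n) xs))
     else 0)"

definition gerstenhaber_bracket ::
    "('k::field \<Rightarrow> 'a::ab_group_add \<Rightarrow> 'a) \<Rightarrow> nat \<Rightarrow> nat \<Rightarrow>
     ('a list \<Rightarrow> 'a) \<Rightarrow> ('a list \<Rightarrow> 'a) \<Rightarrow> ('a list \<Rightarrow> 'a)" where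
  "gerstenhaber_bracket scale m n f g = (\<lambda>xs.
     diamond scale m n f g xs - scale ((- 1) ^ (m * n)) (diamond scale n m g f xs))"

text \<open>
  The index set is empty unless \<open>1 \<le> i \<le> m + n + 1\<close>, so the result is again a tuple in the
  above sense.
\<close>

definition compatible_bracket ::
    "('k::field \<Rightarrow> 'a::ab_group_add \<Rightarrow> 'a) \<Rightarrow> nat \<Rightarrow> nat \<Rightarrow>
     (nat \<Rightarrow> 'a list \<Rightarrow> 'a) \<Rightarrow> (nat \<Rightarrow> 'a list \<Rightarrow> 'a) \<Rightarrow> (nat \<Rightarrow> 'a list \<Rightarrow> 'a)" where
  "compatible_bracket scale m n F G = (\<lambda>i.
     \<Sum>(q, r) \<in> {(q, r). q \<in> {1..m + 1} \<and> r \<in> {1..n + 1} \<and> q + r = i + 1}.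
       gerstenhaber_bracket scale m n (F q) (G r))"

definition scale_cochain ::
    "('k \<Rightarrow> 'a \<Rightarrow> 'a) \<Rightarrow> 'k \<Rightarrow> (nat \<Rightarrow> 'a list \<Rightarrow> 'a) \<Rightarrow> (nat \<Rightarrow> 'a list \<Rightarrow> 'a)" where
  "scale_cochain scale c F = (\<lambda>i xs. scale c (F i xs))"

definition product_cochain :: "('a::zero \<Rightarrow> 'a \<Rightarrow> 'a) \<Rightarrow> 'a list \<Rightarrow> 'a" where
  "product_cochain p = (\<lambda>xs. if length xs = 2 then p (xs ! 0) (xs ! 1) else 0)"

definition product_pair ::
    "('a::zero \<Rightarrow> 'a \<Rightarrow> 'a) \<Rightarrow> ('a \<Rightarrow> 'a \<Rightarrow> 'a) \<Rightarrow> (nat \<Rightarrow> 'a list \<Rightarrow> 'a)" where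
  "product_pair p1 p2 =
    (\<lambda>i. if i = 1 then product_cochain p1 else if i = 2 then product_cochain p2 else 0)"


section \<open>Cohomology\<close>

text \<open>\<open>coboundary scale mu1 mu2 n\<close> is \<open>\<delta>\<^sub>c\<close> on cochains of degree \<open>n \<ge> 1\<close>.\<close>

definition coboundary ::
    "('k::field \<Rightarrow> 'a::ab_group_add \<Rightarrow> 'a) \<Rightarrow> ('a \<Rightarrow> 'a \<Rightarrow> 'a) \<Rightarrow> ('a \<Rightarrow> 'a \<Rightarrow> 'a) \<Rightarrow>
     nat \<Rightarrow> (nat \<Rightarrow> 'a list \<Rightarrow> 'a) \<Rightarrow> (nat \<Rightarrow> 'a list \<Rightarrow> 'a)" where
  "coboundary scale mu1 mu2 n F =
    scale_cochain scale ((- 1) ^ (n - 1))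
      (compatible_bracket scale 1 (n - 1) (product_pair mu1 mu2) F)"

definition Z3 ::
    "('k::field \<Rightarrow> 'a::ab_group_add \<Rightarrow> 'a) \<Rightarrow> ('a \<Rightarrow> 'a \<Rightarrow> 'a) \<Rightarrow> ('a \<Rightarrow> 'a \<Rightarrow> 'a) \<Rightarrow>
     (nat \<Rightarrow> 'a list \<Rightarrow> 'a) monoid" where
  "Z3 scale mu1 mu2 =
    \<lparr>carrier = {F \<in> compatible_cochains scale 3. coboundary scale mu1 mu2 3 F = 0},
     monoid.mult = (+), one = 0\<rparr>"

definition B3 ::
    "('k::field \<Rightarrow> 'a::ab_group_add \<Rightarrow> 'a) \<Rightarrow> ('a \<Rightarrow> 'a \<Rightarrow> 'a) \<Rightarrow> ('a \<Rightarrow> 'a \<Rightarrow> 'a) \<Rightarrow>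
     (nat \<Rightarrow> 'a list \<Rightarrow> 'a) set" where
  "B3 scale mu1 mu2 = coboundary scale mu1 mu2 2 ` compatible_cochains scale 2"

text \<open>
  Only the underlying additive group of the quotient space is recorded; its neutral element
  is the zero class.
\<close>

definition H3 ::
    "('k::field \<Rightarrow> 'a::ab_group_add \<Rightarrow> 'a) \<Rightarrow> ('a \<Rightarrow> 'a \<Rightarrow> 'a) \<Rightarrow> ('a \<Rightarrow> 'a \<Rightarrow> 'a) \<Rightarrow>
     (nat \<Rightarrow> 'a list \<Rightarrow> 'a) set monoid" where
  "H3 scale mu1 mu2 = Z3 scale mu1 mu2 Mod B3 scale mu1 mu2"

definition H3_class ::
    "('k::field \<Rightarrow> 'a::ab_group_add \<Rightarrow> 'a) \<Rightarrow> ('a \<Rightarrow> 'a \<Rightarrow> 'a) \<Rightarrow> ('a \<Rightarrow> 'a \<Rightarrow> 'a) \<Rightarrow>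
     (nat \<Rightarrow> 'a list \<Rightarrow> 'a) \<Rightarrow> (nat \<Rightarrow> 'a list \<Rightarrow> 'a) set" where
  "H3_class scale mu1 mu2 F = B3 scale mu1 mu2 #>\<^bsub>Z3 scale mu1 mu2\<^esub> F"


section \<open>Deformations of finite order\<close>

text \<open>
  \<open>K[[t]]/(t\<^sup>d)\<close> and \<open>A[[t]]/(t\<^sup>d)\<close> are modelled by the representatives of degree less than
  \<open>d\<close>, that is, by the power series fixed by \<open>fps_cutoff d\<close>.
\<close>

definition truncated_ring :: "nat \<Rightarrow> 'k::comm_ring_1 fps ring" where
  "truncated_ring d =
    \<lparr>carrier = {a. fps_cutoff d a = a}, monoid.mult = (\<lambda>a b. fps_cutoff d (a * b)),
     one = fps_cutoff d 1, ring.zero = 0, add = (+)\<rparr>"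

text \<open>The \<open>t\<close>-linear extension of a map in two arguments to power series (Cauchy product).\<close>

definition fps_extend ::
    "('b::zero \<Rightarrow> 'c::zero \<Rightarrow> 'd::comm_monoid_add) \<Rightarrow> 'b fps \<Rightarrow> 'c fps \<Rightarrow> 'd fps" where
  "fps_extend b x y = Abs_fps (\<lambda>n. \<Sum>j = 0..n. b (fps_nth x j) (fps_nth y (n - j)))"

definition truncated_module ::
    "('k::zero \<Rightarrow> 'a::ab_group_add \<Rightarrow> 'a) \<Rightarrow> nat \<Rightarrow> ('k fps, 'a fps) module" where
  "truncated_module scale d =
    \<lparr>carrier = {x. fps_cutoff d x = x}, monoid.mult = undefined, one = undefined,
     ring.zero = 0, add = (+), module.smult = (\<lambda>a x. fps_cutoff d (fps_extend scale a x))\<rparr>"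

text \<open>
  The product \<open>\<Sum>i\<le>N. t\<^sup>i m\<^sub>i\<close> on \<open>A[[t]]/(t\<^bsup>N+1\<^esup>)\<close>. Here and below, a polynomial
  \<open>\<Sum>i\<le>N. t\<^sup>i m\<^sub>i\<close> is given by a sequence \<open>m\<close> of which only the entries up to \<open>N\<close> matter.
\<close>

definition deformed_product ::
    "('k::comm_ring_1 \<Rightarrow> 'a::ab_group_add \<Rightarrow> 'a) \<Rightarrow> nat \<Rightarrow> (nat \<Rightarrow> 'a \<Rightarrow> 'a \<Rightarrow> 'a) \<Rightarrow>
     'a fps \<Rightarrow> 'a fps \<Rightarrow> 'a fps" where
  "deformed_product scale N m x y =
    fps_cutoff (N + 1) (\<Sum>i = 0..N. fps_extend scale (fps_X ^ i) (fps_extend (m i) x y))"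

definition order_deformation ::
    "('k::field \<Rightarrow> 'a::ab_group_add \<Rightarrow> 'a) \<Rightarrow> ('a \<Rightarrow> 'a \<Rightarrow> 'a) \<Rightarrow> ('a \<Rightarrow> 'a \<Rightarrow> 'a) \<Rightarrow> nat \<Rightarrow>
     (nat \<Rightarrow> 'a \<Rightarrow> 'a \<Rightarrow> 'a) \<Rightarrow> (nat \<Rightarrow> 'a \<Rightarrow> 'a \<Rightarrow> 'a) \<Rightarrow> bool" where
  "order_deformation scale mu1 mu2 N m1 m2 \<longleftrightarrow>
    (\<forall>i\<le>N. bilinear_product ring_of_type_algebra (module_of_scale scale) (m1 i) \<and>
           bilinear_product ring_of_type_algebra (module_of_scale scale) (m2 i)) \<and>
    m1 0 = mu1 \<and> m2 0 = mu2 \<and>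
    compatible_assoc_algebra (truncated_ring (N + 1)) (truncated_module scale (N + 1))
      (deformed_product scale N m1) (deformed_product scale N m2)"

definition extensible ::
    "('k::field \<Rightarrow> 'a::ab_group_add \<Rightarrow> 'a) \<Rightarrow> ('a \<Rightarrow> 'a \<Rightarrow> 'a) \<Rightarrow> ('a \<Rightarrow> 'a \<Rightarrow> 'a) \<Rightarrow> nat \<Rightarrow>
     (nat \<Rightarrow> 'a \<Rightarrow> 'a \<Rightarrow> 'a) \<Rightarrow> (nat \<Rightarrow> 'a \<Rightarrow> 'a \<Rightarrow> 'a) \<Rightarrow> bool" where
  "extensible scale mu1 mu2 N m1 m2 \<longleftrightarrow>
    (\<exists>p1 p2. bilinear_product ring_of_type_algebra (module_of_scale scale) p1 \<and>
             bilinear_product ring_of_type_algebra (module_of_scale scale) p2 \<and>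
             order_deformation scale mu1 mu2 (N + 1) (m1(N + 1 := p1)) (m2(N + 1 := p2)))"

definition obstruction ::
    "('k::field_char_0 \<Rightarrow> 'a::ab_group_add \<Rightarrow> 'a) \<Rightarrow> nat \<Rightarrow>
     (nat \<Rightarrow> 'a \<Rightarrow> 'a \<Rightarrow> 'a) \<Rightarrow> (nat \<Rightarrow> 'a \<Rightarrow> 'a \<Rightarrow> 'a) \<Rightarrow> (nat \<Rightarrow> 'a list \<Rightarrow> 'a)" where
  "obstruction scale N m1 m2 =
    scale_cochain scale (- (1 / 2))
      (\<Sum>(i, j) \<in> {(i, j). i \<ge> 1 \<and> j \<ge> 1 \<and> i + j = N + 1}.
         compatible_bracket scale 1 1 (product_pair (m1 i) (m2 i)) (product_pair (m1 j) (m2 j)))"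

end

theory Submission
  imports Defs
begin

text \<open>
  Write \<open>m\<^sub>i\<close> for the pair formed by the coefficients of \<open>t\<^sup>i\<close> in the two deformed products and
  \<open>m\<^sub>0 = \<mu>\<close> for the given pair. Comparing coefficients of constant power series, and conversely
  expanding by bilinearity, shows that the truncated products form a compatible associative
  algebra iff for every \<open>n \<le> N\<close> certain sums of associators over \<open>i + j = n\<close> vanish
  (\<open>order_deformation_iff\<close>). The bracket of two pairs of products consists of symmetrized
  associators, so that in characteristic different from 2 these conditions are the
  Maurer--Cartan equations \<open>\<Sum>\<^bsub>i+j=n\<^esub> [m\<^sub>i, m\<^sub>j] = 0\<close> (\<open>deformation_equations_iff_bracket\<close>).

  A continuation of an order \<open>N\<close> deformation by a pair \<open>P\<close> in degree \<open>N + 1\<close> therefore has to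
  satisfy only the equation in degree \<open>N + 1\<close>. There \<open>P\<close> enters in two terms, both equal to
  \<open>[\<mu>, P]\<close> because the bracket is symmetric in this degree; the other terms add up to \<open>-2 Ob\<close>
  (\<open>sum_product_bracket_eq_obstruction\<close>). So the equation reads \<open>2 ([\<mu>, P] - Ob) = 0\<close>, that is,
  \<open>Ob = - \<delta> P\<close>. The pairs \<open>P\<close> of bilinear products are exactly the 2-cochains
  (\<open>compatible_cochains_2_iff\<close>) and the coboundaries form a group, whence a continuation exists
  iff \<open>Ob\<close> is a coboundary. Finally a coset of a group of coboundaries is trivial iff its
  representative lies in that group (\<open>H3_class_eq_one_iff\<close>).
\<close>

section \<open>Triple convolutions\<close>

definition compositions3 :: "nat \<Rightarrow> (nat \<times> nat \<times> nat) set" where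
  "compositions3 n = {(i, j, k). i + j + k = n}"

definition simplex3 :: "nat \<Rightarrow> (nat \<times> nat \<times> nat) set" where
  "simplex3 n = {(a, b, c). a + b + c \<le> n}"

lemma finite_compositions3 [simp]: "finite (compositions3 n)"
  by (rule finite_subset[of _ "{..n} \<times> {..n} \<times> {..n}"]) (auto simp: compositions3_def)

lemma finite_simplex3 [simp]: "finite (simplex3 n)"
  by (rule finite_subset[of _ "{..n} \<times> {..n} \<times> {..n}"]) (auto simp: simplex3_def)

lemma sum_compositions3:
  fixes f :: "nat \<Rightarrow> nat \<Rightarrow> nat \<Rightarrow> 'a::comm_monoid_add"
  shows "(\<Sum>i\<le>n. \<Sum>j\<le>n - i. f i j (n - i - j)) = (\<Sum>(i, j, k)\<in>compositions3 n. f i j k)"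
  by (subst sum.Sigma, simp, simp,
      rule sum.reindex_bij_witness[where i="\<lambda>(i, j, k). (i, j)" and j="\<lambda>(i, j). (i, j, n - i - j)"])
     (auto simp: compositions3_def)

text \<open>
  With \<open>compositions3\<close> for the degrees of (product, left factor, right factor), the left-hand side
  here lists the terms of a coefficient of \<open>(x y) z\<close>, and in \<open>sum_compositions3_right\<close> of
  \<open>x (y z)\<close>. Both are regrouped by the degrees \<open>(a, b, c)\<close> taken from \<open>x\<close>, \<open>y\<close>, \<open>z\<close>; what is left of
  the degree is shared by the outer and the inner product.
\<close>

lemma sum_compositions3_left:
  fixes f :: "nat \<Rightarrow> nat \<Rightarrow> nat \<Rightarrow> nat \<Rightarrow> nat \<Rightarrow> 'a::comm_monoid_add"
  shows "(\<Sum>(i, s, c)\<in>compositions3 n. \<Sum>(j, a, b)\<in>compositions3 s. f i j a b c) =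
    (\<Sum>(a, b, c)\<in>simplex3 n. \<Sum>i\<le>n - (a + b + c). f i (n - (a + b + c) - i) a b c)"
proof -
  have "(\<Sum>u\<in>compositions3 n. \<Sum>v\<in>compositions3 (fst (snd u)).
      f (fst u) (fst v) (fst (snd v)) (snd (snd v)) (snd (snd u))) =
    (\<Sum>u\<in>simplex3 n. \<Sum>i\<le>n - (fst u + fst (snd u) + snd (snd u)).
      f i (n - (fst u + fst (snd u) + snd (snd u)) - i) (fst u) (fst (snd u)) (snd (snd u)))"
    by (subst (1 2) sum.Sigma, simp_all,
        rule sum.reindex_bij_witness[where
          i="\<lambda>((a, b, c), i). ((i, n - c - i, c), (n - (a + b + c) - i, a, b))" and
          j="\<lambda>((i, s, c), (j, a, b)). ((a, b, c), i)"])
       (auto simp: compositions3_def simplex3_def)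
  then show ?thesis
    by (simp add: case_prod_unfold)
qed

lemma sum_compositions3_right:
  fixes f :: "nat \<Rightarrow> nat \<Rightarrow> nat \<Rightarrow> nat \<Rightarrow> nat \<Rightarrow> 'a::comm_monoid_add"
  shows "(\<Sum>(i, a, s)\<in>compositions3 n. \<Sum>(j, b, c)\<in>compositions3 s. f i j a b c) =
    (\<Sum>(a, b, c)\<in>simplex3 n. \<Sum>i\<le>n - (a + b + c). f i (n - (a + b + c) - i) a b c)"
proof -
  have "(\<Sum>u\<in>compositions3 n. \<Sum>v\<in>compositions3 (snd (snd u)).
      f (fst u) (fst v) (fst (snd u)) (fst (snd v)) (snd (snd v))) =
    (\<Sum>u\<in>simplex3 n. \<Sum>i\<le>n - (fst u + fst (snd u) + snd (snd u)).
      f i (n - (fst u + fst (snd u) + snd (snd u)) - i) (fst u) (fst (snd u)) (snd (snd u)))"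
    by (subst (1 2) sum.Sigma, simp_all,
        rule sum.reindex_bij_witness[where
          i="\<lambda>((a, b, c), i). ((i, a, n - a - i), (n - (a + b + c) - i, b, c))" and
          j="\<lambda>((i, a, s), (j, b, c)). ((a, b, c), i)"])
       (auto simp: compositions3_def simplex3_def)
  then show ?thesis
    by (simp add: case_prod_unfold)
qed

section \<open>Truncated power series\<close>

lemma cring_truncated_ring: "cring (truncated_ring d :: 'k::comm_ring_1 fps ring)"
proof (rule cringI)
  show "abelian_group (truncated_ring d :: 'k fps ring)"
    by (rule abelian_groupI)
       (auto simp: truncated_ring_def fps_cutoff_add fps_cutoff_uminus algebra_simps
             intro!: exI[of _ "- x" for x])
  have cut_left: "fps_cutoff d (fps_cutoff d a * b) = fps_cutoff d (a * b)" for a b :: "'k fps"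
    by (rule fps_ext) (simp add: fps_cutoff_left_mult_nth)
  have cut_right: "fps_cutoff d (a * fps_cutoff d b) = fps_cutoff d (a * b)" for a b :: "'k fps"
    by (rule fps_ext) (simp add: fps_cutoff_right_mult_nth)
  have idem: "fps_cutoff d (fps_cutoff d a) = fps_cutoff d a" for a :: "'k fps"
    by (rule fps_ext) simp
  show "comm_monoid (truncated_ring d :: 'k fps ring)"
    by (rule comm_monoidI) (auto simp: truncated_ring_def idem cut_left cut_right mult_ac)
qed (simp add: truncated_ring_def fps_cutoff_add algebra_simps)

lemma fps_extend_nth [simp]:
  "fps_nth (fps_extend b x y) n = (\<Sum>j\<le>n. b (fps_nth x j) (fps_nth y (n - j)))"
  by (simp add: fps_extend_def atMost_atLeast0)

lemma module_truncated_module: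
  assumes "vector_space scale"
  shows "Module.module (truncated_ring d) (truncated_module scale d)"
proof -
  interpret vector_space scale by fact
  show ?thesis
  proof (rule moduleI)
    show "cring (truncated_ring d :: 'a fps ring)"
      by (rule cring_truncated_ring)
    show "abelian_group (truncated_module scale d)"
      by (rule abelian_groupI)
         (auto simp: truncated_module_def fps_cutoff_add fps_cutoff_uminus algebra_simps
               intro!: exI[of _ "- x" for x])
    fix x assume x: "x \<in> carrier (truncated_module scale d)"
    show "\<one>\<^bsub>truncated_ring d\<^esub> \<odot>\<^bsub>truncated_module scale d\<^esub> x = x"
    proof (rule fps_ext)
      fix n
      have "(\<Sum>j\<le>n. scale (if j = 0 then 1 else 0) (fps_nth x (n - j))) = fps_nth x n"
        by (simp add: if_distrib[of "\<lambda>c. scale c y" for y] cong: if_cong)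
      moreover have "n \<ge> d \<Longrightarrow> fps_nth x n = 0"
        using x by (metis (mono_tags, lifting) fps_cutoff_nth linorder_not_le mem_Collect_eq
          partial_object.select_convs(1) truncated_module_def)
      moreover have "fps_nth (fps_cutoff d 1) j = (if j = 0 then 1 else 0)" if "n < d" "j \<le> n" for j
        using that by simp
      ultimately show "fps_nth (\<one>\<^bsub>truncated_ring d\<^esub> \<odot>\<^bsub>truncated_module scale d\<^esub> x) n = fps_nth x n"
        by (auto simp: truncated_module_def truncated_ring_def cong: sum.cong_simp)
    qed
  next
    fix a b x
    have assoc: "(\<Sum>i\<le>n. scale (\<Sum>j\<le>i. fps_nth a j * fps_nth b (i - j)) (fps_nth x (n - i))) =
      (\<Sum>j\<le>n. scale (fps_nth a j) (\<Sum>i\<le>n - j. scale (fps_nth b i) (fps_nth x (n - j - i))))" for n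
      unfolding scale_sum_left scale_sum_right scale_scale
      by (subst (1 2) sum.Sigma, simp_all,
          rule sum.reindex_bij_witness[where i="\<lambda>(j, i). (i + j, j)" and j="\<lambda>(i, j). (j, i - j)"])
         auto
    show "(a \<otimes>\<^bsub>truncated_ring d\<^esub> b) \<odot>\<^bsub>truncated_module scale d\<^esub> x =
      a \<odot>\<^bsub>truncated_module scale d\<^esub> (b \<odot>\<^bsub>truncated_module scale d\<^esub> x)"
    proof (rule fps_ext)
      fix n
      have "n - j < d" if "n < d" for j
        using that by simp
      then show "fps_nth ((a \<otimes>\<^bsub>truncated_ring d\<^esub> b) \<odot>\<^bsub>truncated_module scale d\<^esub> x) n =
        fps_nth (a \<odot>\<^bsub>truncated_module scale d\<^esub> (b \<odot>\<^bsub>truncated_module scale d\<^esub> x)) n"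
        by (cases "n < d")
           (simp_all add: assoc truncated_module_def truncated_ring_def fps_mult_nth
              flip: atMost_atLeast0 cong: sum.cong_simp)
    qed
  qed (auto simp: truncated_module_def truncated_ring_def fps_eq_iff scale_left_distrib
         scale_right_distrib sum.distrib)
qed

section \<open>Deformed products\<close>

abbreviation bilinear_on :: "('k::field \<Rightarrow> 'a::ab_group_add \<Rightarrow> 'a) \<Rightarrow> ('a \<Rightarrow> 'a \<Rightarrow> 'a) \<Rightarrow> bool" where
  "bilinear_on scale \<equiv> bilinear_product ring_of_type_algebra (module_of_scale scale)"

lemma bilinear_on_iff:
  "bilinear_on scale p \<longleftrightarrow>
    (\<forall>x y z. p (x + y) z = p x z + p y z \<and> p z (x + y) = p z x + p z y) \<and>
    (\<forall>c x y. p (scale c x) y = scale c (p x y) \<and> p x (scale c y) = scale c (p x y))"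
  by (simp add: bilinear_product_def module_of_scale_def ring_of_type_algebra_def)

lemma bilinear_on_0 [simp]:
  assumes "bilinear_on scale p"
  shows "p 0 y = 0" "p x 0 = 0"
proof -
  have "p (0 + 0) y = p 0 y + p 0 y" "p x (0 + 0) = p x 0 + p x 0"
    using assms unfolding bilinear_on_iff by blast+
  then show "p 0 y = 0" "p x 0 = 0" by simp_all
qed

lemma bilinear_on_sum:
  assumes "bilinear_on scale p"
  shows "p (\<Sum>i\<in>S. f i) y = (\<Sum>i\<in>S. p (f i) y)" "p x (\<Sum>i\<in>S. f i) = (\<Sum>i\<in>S. p x (f i))"
proof -
  note b = bilinear_on_0[OF assms]
  have add: "p (u + v) w = p u w + p v w" "p w (u + v) = p w u + p w v" for u v w
    using assms unfolding bilinear_on_iff by blast+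
  show "p (\<Sum>i\<in>S. f i) y = (\<Sum>i\<in>S. p (f i) y)"
    by (induction S rule: infinite_finite_induct) (simp_all add: b add)
  show "p x (\<Sum>i\<in>S. f i) = (\<Sum>i\<in>S. p x (f i))"
    by (induction S rule: infinite_finite_induct) (simp_all add: b add)
qed

lemma deformed_product_nth:
  assumes "vector_space scale"
  shows "fps_nth (deformed_product scale N m x y) n =
    (if n \<le> N then \<Sum>(i, j, k)\<in>compositions3 n. m i (fps_nth x j) (fps_nth y k) else 0)"
proof (cases "n \<le> N")
  case True
  interpret vector_space scale by fact
  have "fps_nth (fps_extend scale (fps_X ^ i) z) n = (if i \<le> n then fps_nth z (n - i) else 0)" for i z
    by (simp add: fps_X_power_nth if_distrib[of "\<lambda>c. scale c y" for y] cong: if_cong)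
  then have "fps_nth (deformed_product scale N m x y) n =
      (\<Sum>i = 0..N. if i \<le> n then fps_nth (fps_extend (m i) x y) (n - i) else 0)"
    using True by (simp add: deformed_product_def fps_sum_nth del: fps_extend_nth)
  also have "\<dots> = (\<Sum>i\<le>n. fps_nth (fps_extend (m i) x y) (n - i))"
    using True by (intro sum.mono_neutral_cong_right) auto
  also have "\<dots> = (\<Sum>(i, j, k)\<in>compositions3 n. m i (fps_nth x j) (fps_nth y k))"
    by (simp flip: sum_compositions3)
  finally show ?thesis using True by simp
qed (simp add: deformed_product_def)

text \<open>
  Passing to opposite products turns every statement about the left argument into one about
  the right argument.
\<close>

lemma deformed_product_flip:
  assumes "vector_space scale"
  shows "deformed_product scale N (\<lambda>i a b. m i b a) y x = deformed_product scale N m x y"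
proof (rule fps_ext)
  fix n
  have "(\<Sum>(i, k, j)\<in>compositions3 n. m i (fps_nth x j) (fps_nth y k)) =
    (\<Sum>(i, j, k)\<in>compositions3 n. m i (fps_nth x j) (fps_nth y k))"
    by (rule sum.reindex_bij_witness[where i="\<lambda>(i, j, k). (i, k, j)" and j="\<lambda>(i, j, k). (i, k, j)"])
       (auto simp: compositions3_def)
  then show "fps_nth (deformed_product scale N (\<lambda>i a b. m i b a) y x) n =
    fps_nth (deformed_product scale N m x y) n"
    by (simp add: deformed_product_nth[OF assms])
qed

text \<open>
  Degreewise, linearity over the truncated power series ring amounts to moving a scalar
  coefficient of degree \<open>r\<close> out of each \<open>m i\<close> and shifting the degree of the argument by \<open>r\<close>.
\<close>

lemma bilinear_deformed_product:
  assumes "vector_space scale" and bil: "\<And>i. i \<le> N \<Longrightarrow> bilinear_on scale (m i)"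
  shows "bilinear_product (truncated_ring (N + 1)) (truncated_module scale (N + 1))
    (deformed_product scale N m)"
proof -
  interpret vector_space scale by fact
  note nth = deformed_product_nth[OF assms(1)]
  have le: "i \<le> N" if "(i, j, k) \<in> compositions3 n" "n \<le> N" for i j k n
    using that by (auto simp: compositions3_def)
  have add: "deformed_product scale N m (x + y) z = deformed_product scale N m x z + deformed_product scale N m y z"
    "deformed_product scale N m z (x + y) = deformed_product scale N m z x + deformed_product scale N m z y" for x y z
    using bil[OF le] by (auto intro!: fps_ext sum.cong simp: nth bilinear_on_iff simp flip: sum.distrib)
  let ?sm = "\<lambda>c x. fps_cutoff (N + 1) (fps_extend scale c x)"
  have smult_left: "deformed_product scale N m (?sm c x) y = ?sm c (deformed_product scale N m x y)"
    if bil: "\<And>i. i \<le> N \<Longrightarrow> bilinear_on scale (m i)" for m c x y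
  proof (rule fps_ext)
    fix n
    show "fps_nth (deformed_product scale N m (?sm c x) y) n =
      fps_nth (?sm c (deformed_product scale N m x y)) n"
    proof (cases "n \<le> N")
      case True
      then have "\<And>r. n - r \<le> N" by simp
      have "(\<Sum>(i, s, k)\<in>compositions3 n. m i (fps_nth (?sm c x) s) (fps_nth y k)) =
        (\<Sum>u\<in>compositions3 n. \<Sum>r\<le>fst (snd u).
            scale (fps_nth c r) (m (fst u) (fps_nth x (fst (snd u) - r)) (fps_nth y (snd (snd u)))))"
      proof (rule sum.cong[OF refl], clarsimp)
        fix i s k assume "(i, s, k) \<in> compositions3 n"
        then have "i \<le> N" "s \<le> N" using True by (auto simp: compositions3_def)
        with bil[of i] show "(s < Suc N \<longrightarrow> m i (\<Sum>j\<le>s. scale (fps_nth c j) (fps_nth x (s - j))) (fps_nth y k) =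
          (\<Sum>r\<le>s. scale (fps_nth c r) (m i (fps_nth x (s - r)) (fps_nth y k)))) \<and>
          (\<not> s < Suc N \<longrightarrow> m i 0 (fps_nth y k) =
          (\<Sum>r\<le>s. scale (fps_nth c r) (m i (fps_nth x (s - r)) (fps_nth y k))))"
          by (simp add: bilinear_on_sum[OF bil] bilinear_on_iff)
      qed
      also have "\<dots> = (\<Sum>r\<le>n. \<Sum>u\<in>compositions3 (n - r).
            scale (fps_nth c r) (m (fst u) (fps_nth x (fst (snd u))) (fps_nth y (snd (snd u)))))"
        by (subst (1 2) sum.Sigma, simp_all,
            rule sum.reindex_bij_witness[where i="\<lambda>(r, (i, j, k)). ((i, j + r, k), r)" and
              j="\<lambda>((i, s, k), r). (r, (i, s - r, k))"])
           (auto simp: compositions3_def)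
      finally show ?thesis
        using True \<open>\<And>r. n - r \<le> N\<close> by (simp add: nth scale_sum_right case_prod_unfold)
    qed (simp add: nth)
  qed
  have smult_right: "deformed_product scale N m x (?sm c y) = ?sm c (deformed_product scale N m x y)"
    for c x y
    using smult_left[of "\<lambda>i a b. m i b a" c y x] bil
    by (simp add: bilinear_on_iff flip: deformed_product_flip[OF assms(1), of N m])
  show ?thesis
    unfolding bilinear_product_def truncated_module_def
    by (simp add: add smult_left[OF bil, simplified] smult_right[simplified]) (simp add: fps_eq_iff nth)
qed

definition associator :: "('a::ab_group_add \<Rightarrow> 'a \<Rightarrow> 'a) \<Rightarrow> ('a \<Rightarrow> 'a \<Rightarrow> 'a) \<Rightarrow> 'a \<Rightarrow> 'a \<Rightarrow> 'a \<Rightarrow> 'a" where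
  "associator p q a b c = p (q a b) c - p a (q b c)"

definition associator_coeff ::
    "(nat \<Rightarrow> 'a::ab_group_add \<Rightarrow> 'a \<Rightarrow> 'a) \<Rightarrow> (nat \<Rightarrow> 'a \<Rightarrow> 'a \<Rightarrow> 'a) \<Rightarrow> nat \<Rightarrow> 'a \<Rightarrow> 'a \<Rightarrow> 'a \<Rightarrow> 'a" where
  "associator_coeff p q n a b c = (\<Sum>i\<le>n. associator (p i) (q (n - i)) a b c)"

text \<open>
  The coefficients of the associator of the deformed products, on arbitrary power series, are sums
  of values of \<open>associator_coeff\<close> in degrees at most \<open>n\<close>; this is why it is enough to test the
  deformation on constant power series.
\<close>

lemma associator_deformed_product_nth:
  assumes "vector_space scale" and bil: "\<And>i. i \<le> N \<Longrightarrow> bilinear_on scale (p i)" and "n \<le> N"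
  shows "fps_nth (associator (deformed_product scale N p) (deformed_product scale N q) x y z) n =
    (\<Sum>(a, b, c)\<in>simplex3 n. associator_coeff p q (n - (a + b + c)) (fps_nth x a) (fps_nth y b) (fps_nth z c))"
proof -
  note nth = deformed_product_nth[OF assms(1)]
  have "fps_nth (deformed_product scale N p (deformed_product scale N q x y) z) n =
    (\<Sum>(i, s, c)\<in>compositions3 n. \<Sum>(j, a, b)\<in>compositions3 s. p i (q j (fps_nth x a) (fps_nth y b)) (fps_nth z c))"
    unfolding nth if_P[OF \<open>n \<le> N\<close>]
  proof (rule sum.cong[OF refl], clarsimp)
    fix i s c assume "(i, s, c) \<in> compositions3 n"
    then have "i \<le> N" "s \<le> N" using \<open>n \<le> N\<close> by (auto simp: compositions3_def)
    then show "(s \<le> N \<longrightarrow> p i (\<Sum>(i, j, k)\<in>compositions3 s. q i (fps_nth x j) (fps_nth y k)) (fps_nth z c) =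
        (\<Sum>(j, a, b)\<in>compositions3 s. p i (q j (fps_nth x a) (fps_nth y b)) (fps_nth z c))) \<and>
      (\<not> s \<le> N \<longrightarrow> p i 0 (fps_nth z c) =
        (\<Sum>(j, a, b)\<in>compositions3 s. p i (q j (fps_nth x a) (fps_nth y b)) (fps_nth z c)))"
      by (simp add: bilinear_on_sum[OF bil] case_prod_unfold)
  qed
  moreover have "fps_nth (deformed_product scale N p x (deformed_product scale N q y z)) n =
    (\<Sum>(i, a, s)\<in>compositions3 n. \<Sum>(j, b, c)\<in>compositions3 s. p i (fps_nth x a) (q j (fps_nth y b) (fps_nth z c)))"
    unfolding nth if_P[OF \<open>n \<le> N\<close>]
  proof (rule sum.cong[OF refl], clarsimp)
    fix i a s assume "(i, a, s) \<in> compositions3 n"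
    then have "i \<le> N" "s \<le> N" using \<open>n \<le> N\<close> by (auto simp: compositions3_def)
    then show "(s \<le> N \<longrightarrow> p i (fps_nth x a) (\<Sum>(i, j, k)\<in>compositions3 s. q i (fps_nth y j) (fps_nth z k)) =
        (\<Sum>(j, b, c)\<in>compositions3 s. p i (fps_nth x a) (q j (fps_nth y b) (fps_nth z c)))) \<and>
      (\<not> s \<le> N \<longrightarrow> p i (fps_nth x a) 0 =
        (\<Sum>(j, b, c)\<in>compositions3 s. p i (fps_nth x a) (q j (fps_nth y b) (fps_nth z c))))"
      by (simp add: bilinear_on_sum[OF bil] case_prod_unfold)
  qed
  ultimately show ?thesis
    unfolding sum_compositions3_left sum_compositions3_right
    by (simp add: associator_def[of "deformed_product scale N p"] associator_coeff_def
        associator_def[of "p i" for i] case_prod_unfold sum_subtractf del: diff_diff_left)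
qed

text \<open>
  The part of associativity and compatibility that concerns the coefficient of \<open>t\<^sup>n\<close> on constants.
\<close>

definition deformation_equations ::
    "(nat \<Rightarrow> 'a::ab_group_add \<Rightarrow> 'a \<Rightarrow> 'a) \<Rightarrow> (nat \<Rightarrow> 'a \<Rightarrow> 'a \<Rightarrow> 'a) \<Rightarrow> nat \<Rightarrow> bool" where
  "deformation_equations m1 m2 n \<longleftrightarrow> (\<forall>a b c.
     associator_coeff m1 m1 n a b c = 0 \<and> associator_coeff m2 m2 n a b c = 0 \<and>
     associator_coeff m2 m1 n a b c + associator_coeff m1 m2 n a b c = 0)"

lemma associator_coeff_zero:
  assumes "\<And>i. i \<le> n \<Longrightarrow> bilinear_on scale (p i)" "\<And>i. i \<le> n \<Longrightarrow> bilinear_on scale (q i)"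
    and "a = 0 \<or> b = 0 \<or> c = 0"
  shows "associator_coeff p q n a b c = 0"
  unfolding associator_coeff_def
proof (rule sum.neutral, rule ballI)
  fix i assume "i \<in> {..n}"
  then have p: "bilinear_on scale (p i)" and q: "bilinear_on scale (q (n - i))"
    using assms by auto
  show "associator (p i) (q (n - i)) a b c = 0"
    using assms(3) by (auto simp: associator_def bilinear_on_0[OF p] bilinear_on_0[OF q])
qed

lemma associator_deformed_product_const:
  assumes "vector_space scale" and p: "\<And>i. i \<le> N \<Longrightarrow> bilinear_on scale (p i)"
    and q: "\<And>i. i \<le> N \<Longrightarrow> bilinear_on scale (q i)" and "n \<le> N"
  shows "fps_nth (associator (deformed_product scale N p) (deformed_product scale N q)
      (fps_const a) (fps_const b) (fps_const c)) n = associator_coeff p q n a b c"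
proof -
  have "(\<Sum>(i, j, k)\<in>simplex3 n. associator_coeff p q (n - (i + j + k))
      (fps_nth (fps_const a) i) (fps_nth (fps_const b) j) (fps_nth (fps_const c) k)) =
    (\<Sum>(i, j, k)\<in>{(0, 0, 0)}. associator_coeff p q (n - (i + j + k))
      (fps_nth (fps_const a) i) (fps_nth (fps_const b) j) (fps_nth (fps_const c) k))"
    using \<open>n \<le> N\<close>
    by (intro sum.mono_neutral_right finite_simplex3) (auto simp: simplex3_def intro!: associator_coeff_zero p q)
  then show ?thesis
    by (simp add: associator_deformed_product_nth[OF assms(1) p \<open>n \<le> N\<close>])
qed

text \<open>
  Constants give the equations by \<open>associator_deformed_product_const\<close>, and the equations in degrees
  up to \<open>N\<close> give the identities for all power series by \<open>associator_deformed_product_nth\<close>.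
\<close>

lemma order_deformation_iff:
  fixes scale :: "'k::field \<Rightarrow> 'a::ab_group_add \<Rightarrow> 'a"
  assumes "vector_space scale"
  shows "order_deformation scale mu1 mu2 N m1 m2 \<longleftrightarrow>
    (\<forall>i\<le>N. bilinear_on scale (m1 i) \<and> bilinear_on scale (m2 i)) \<and>
    m1 0 = mu1 \<and> m2 0 = mu2 \<and> (\<forall>n\<le>N. deformation_equations m1 m2 n)"
proof -
  define D1 D2 where D: "D1 = deformed_product scale N m1" "D2 = deformed_product scale N m2"
  define C where "C = carrier (truncated_module scale (N + 1))"
  have "compatible_assoc_algebra (truncated_ring (N + 1)) (truncated_module scale (N + 1)) D1 D2 \<longleftrightarrow>
      (\<forall>n\<le>N. deformation_equations m1 m2 n)"
    if bil: "\<And>i. i \<le> N \<Longrightarrow> bilinear_on scale (m1 i)" "\<And>i. i \<le> N \<Longrightarrow> bilinear_on scale (m2 i)"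
  proof -
    have "compatible_assoc_algebra (truncated_ring (N + 1)) (truncated_module scale (N + 1)) D1 D2 \<longleftrightarrow>
      (\<forall>x\<in>C. \<forall>y\<in>C. \<forall>z\<in>C. associator D1 D1 x y z = 0 \<and> associator D2 D2 x y z = 0 \<and>
        associator D2 D1 x y z + associator D1 D2 x y z = 0)"
    proof -
      have "associator p p x y z = 0 \<longleftrightarrow> p (p x y) z = p x (p y z)" for p and x y z :: "'a fps"
        by (simp add: associator_def)
      moreover have "associator D2 D1 x y z + associator D1 D2 x y z = 0 \<longleftrightarrow>
        D2 (D1 x y) z + D1 (D2 x y) z = D1 x (D2 y z) + D2 x (D1 y z)" for x y z
        unfolding associator_def add_diff_add[symmetric] right_minus_eq by (simp add: add.commute)
      moreover have "a \<oplus>\<^bsub>truncated_module scale (N + 1)\<^esub> b = a + b" for a b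
        by (simp add: truncated_module_def)
      ultimately show ?thesis
        unfolding compatible_assoc_algebra_def C_def D
        using module_truncated_module[OF assms] bilinear_deformed_product[OF assms] bil by simp
    qed
    also have "\<dots> \<longleftrightarrow> (\<forall>n\<le>N. deformation_equations m1 m2 n)"
    proof safe
      fix n assume eqs: "\<forall>x\<in>C. \<forall>y\<in>C. \<forall>z\<in>C. associator D1 D1 x y z = 0 \<and>
        associator D2 D2 x y z = 0 \<and> associator D2 D1 x y z + associator D1 D2 x y z = 0"
        and n: "n \<le> N"
      have const: "fps_const a \<in> C" for a
        by (simp add: C_def truncated_module_def fps_cutoff_fps_const)
      note coeff = associator_deformed_product_const[OF assms _ _ n, folded D]
      show "deformation_equations m1 m2 n"
        unfolding deformation_equations_def
      proof (intro allI)
        fix a b c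
        have "associator D1 D1 (fps_const a) (fps_const b) (fps_const c) = 0"
          "associator D2 D2 (fps_const a) (fps_const b) (fps_const c) = 0"
          "associator D2 D1 (fps_const a) (fps_const b) (fps_const c) +
            associator D1 D2 (fps_const a) (fps_const b) (fps_const c) = 0"
          using eqs const by blast+
        from this[THEN arg_cong[where f="\<lambda>x. fps_nth x n"]]
        show "associator_coeff m1 m1 n a b c = 0 \<and> associator_coeff m2 m2 n a b c = 0 \<and>
          associator_coeff m2 m1 n a b c + associator_coeff m1 m2 n a b c = 0"
          using coeff[of m1 m1 a b c] coeff[of m2 m2 a b c] coeff[of m2 m1 a b c]
            coeff[of m1 m2 a b c] bil by (simp add: D)
      qed
    next
      fix x y z
      assume "\<forall>n\<le>N. deformation_equations m1 m2 n"
      then have eqs: "associator_coeff m1 m1 n a b c = 0" "associator_coeff m2 m2 n a b c = 0"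
        "associator_coeff m2 m1 n a b c + associator_coeff m1 m2 n a b c = 0" if "n \<le> N" for n a b c
        using that by (auto simp: deformation_equations_def)
      have high: "fps_nth (associator (deformed_product scale N p) q x y z) n = 0"
        if "\<not> n \<le> N" for p q n
        using that by (simp add: associator_def deformed_product_nth[OF assms])
      note coeff = associator_deformed_product_nth[OF assms]
      show "associator D1 D1 x y z = 0" "associator D2 D2 x y z = 0"
        by (rule fps_ext, case_tac "n \<le> N",
            auto simp: D high coeff[OF bil(1)] coeff[OF bil(2)] eqs intro!: sum.neutral)+
      show "associator D2 D1 x y z + associator D1 D2 x y z = 0"
        by (rule fps_ext, case_tac "n \<le> N",
            auto simp: D high coeff[OF bil(1)] coeff[OF bil(2)] eqs simp flip: sum.distrib intro!: sum.neutral)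
    qed
    finally show ?thesis .
  qed
  then show ?thesis
    unfolding order_deformation_def D by (auto; blast)
qed

section \<open>Brackets of pairs of products\<close>

definition product_bracket ::
    "('k::field \<Rightarrow> 'a::ab_group_add \<Rightarrow> 'a) \<Rightarrow> ('a \<Rightarrow> 'a \<Rightarrow> 'a) \<Rightarrow> ('a \<Rightarrow> 'a \<Rightarrow> 'a) \<Rightarrow>
     ('a \<Rightarrow> 'a \<Rightarrow> 'a) \<Rightarrow> ('a \<Rightarrow> 'a \<Rightarrow> 'a) \<Rightarrow> nat \<Rightarrow> 'a list \<Rightarrow> 'a" where
  "product_bracket scale p1 p2 q1 q2 =
    compatible_bracket scale 1 1 (product_pair p1 p2) (product_pair q1 q2)"

definition cochain_triple ::
    "('a \<Rightarrow> 'a \<Rightarrow> 'a \<Rightarrow> 'a::zero) \<Rightarrow> ('a \<Rightarrow> 'a \<Rightarrow> 'a \<Rightarrow> 'a) \<Rightarrow> ('a \<Rightarrow> 'a \<Rightarrow> 'a \<Rightarrow> 'a) \<Rightarrow> nat \<Rightarrow> 'a list \<Rightarrow> 'a" where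
  "cochain_triple f1 f2 f3 = (\<lambda>k xs. if length xs = 3 then
     (if k = 1 then f1 (xs ! 0) (xs ! 1) (xs ! 2) else
      if k = 2 then f2 (xs ! 0) (xs ! 1) (xs ! 2) else
      if k = 3 then f3 (xs ! 0) (xs ! 1) (xs ! 2) else 0) else 0)"

lemma cochain_triple_eq_0_iff:
  "cochain_triple f1 f2 f3 = 0 \<longleftrightarrow> (\<forall>a b c. f1 a b c = 0 \<and> f2 a b c = 0 \<and> f3 a b c = 0)"
proof
  assume "cochain_triple f1 f2 f3 = 0"
  then have "cochain_triple f1 f2 f3 k [a, b, c] = 0" for k a b c by simp
  from this[of 1] this[of 2] this[of 3]
  show "\<forall>a b c. f1 a b c = 0 \<and> f2 a b c = 0 \<and> f3 a b c = 0"
    by (simp add: cochain_triple_def)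
qed (simp add: cochain_triple_def fun_eq_iff)

text \<open>
  For two arguments the diamond product has one insertion in each slot, with opposite signs, so it
  is the associator. The sign \<open>(-1)\<^sup>1\<close> in the bracket makes the bracket a symmetrization.
\<close>

lemma gerstenhaber_bracket_products:
  assumes "vector_space scale"
  shows "gerstenhaber_bracket scale 1 1 (product_cochain p) (product_cochain q) xs =
    (if length xs = 3 then associator p q (xs ! 0) (xs ! 1) (xs ! 2) +
      associator q p (xs ! 0) (xs ! 1) (xs ! 2) else 0)"
proof -
  interpret vector_space scale by fact
  have two: "(\<Sum>i = 1..1 + 1. f i) = f 1 + f 2" for f :: "nat \<Rightarrow> 'b"
    by (simp add: numeral_2_eq_2)
  show ?thesis
  proof (cases "length xs = 3")
    case True
    then obtain a b c where "xs = [a, b, c]"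
      by (auto simp: eval_nat_numeral length_Suc_conv)
    then show ?thesis
      unfolding gerstenhaber_bracket_def diamond_def two
      by (simp add: product_cochain_def associator_def)
  qed (simp add: gerstenhaber_bracket_def diamond_def)
qed

lemma product_bracket_eq:
  assumes "vector_space scale"
  shows "product_bracket scale p1 p2 q1 q2 = cochain_triple
    (\<lambda>a b c. associator p1 q1 a b c + associator q1 p1 a b c)
    (\<lambda>a b c. (associator p1 q2 a b c + associator q2 p1 a b c) +
             (associator p2 q1 a b c + associator q1 p2 a b c))
    (\<lambda>a b c. associator p2 q2 a b c + associator q2 p2 a b c)"
proof (intro ext)
  fix k xs
  define I where "I = {(q, r). q \<in> {1..1 + 1::nat} \<and> r \<in> {1..1 + 1::nat} \<and> q + r = k + 1}"
  have "k = 1 \<Longrightarrow> I = {(1, 1)}" "k = 2 \<Longrightarrow> I = {(1, 2), (2, 1)}" "k = 3 \<Longrightarrow> I = {(2, 2)}"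
    "k \<notin> {1, 2, 3} \<Longrightarrow> I = {}"
    unfolding I_def by (auto; presburger)+
  then show "product_bracket scale p1 p2 q1 q2 k xs = cochain_triple
    (\<lambda>a b c. associator p1 q1 a b c + associator q1 p1 a b c)
    (\<lambda>a b c. (associator p1 q2 a b c + associator q2 p1 a b c) +
             (associator p2 q1 a b c + associator q1 p2 a b c))
    (\<lambda>a b c. associator p2 q2 a b c + associator q2 p2 a b c) k xs"
    unfolding product_bracket_def compatible_bracket_def I_def[symmetric] cochain_triple_def
    by (auto simp: product_pair_def gerstenhaber_bracket_products[OF assms, simplified])
qed

lemma product_bracket_commute:
  assumes "vector_space scale"
  shows "product_bracket scale p1 p2 q1 q2 = product_bracket scale q1 q2 p1 p2"
  unfolding product_bracket_eq[OF assms] by (simp add: cochain_triple_def fun_eq_iff algebra_simps)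

text \<open>
  In \<open>p (q + r)\<close> the sum splits by bilinearity of the outer product \<open>p\<close>; in \<open>(q + r) p\<close> it splits
  because sums of products are pointwise.
\<close>

lemma product_bracket_add:
  assumes "vector_space scale" "bilinear_on scale p1" "bilinear_on scale p2"
  shows "product_bracket scale p1 p2 (q1 + r1) (q2 + r2) =
    product_bracket scale p1 p2 q1 q2 + product_bracket scale p1 p2 r1 r2"
  using assms(2,3) unfolding product_bracket_eq[OF assms(1)]
  by (simp add: cochain_triple_def fun_eq_iff associator_def bilinear_on_iff algebra_simps)

lemma sum_cochain_triple:
  "(\<Sum>i\<in>S. cochain_triple (f1 i) (f2 i) (f3 i)) =
    cochain_triple (\<lambda>a b c. \<Sum>i\<in>S. f1 i a b c) (\<lambda>a b c. \<Sum>i\<in>S. f2 i a b c) (\<lambda>a b c. \<Sum>i\<in>S. f3 i a b c)"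
  for f1 :: "'i \<Rightarrow> 'a \<Rightarrow> 'a \<Rightarrow> 'a \<Rightarrow> 'a::ab_group_add"
  by (induction S rule: infinite_finite_induct) (auto simp: cochain_triple_def fun_eq_iff)

lemma add_self_eq_0_iff:
  fixes scale :: "'k::field_char_0 \<Rightarrow> 'a::ab_group_add \<Rightarrow> 'a" and x :: 'a
  assumes "vector_space scale"
  shows "x + x = 0 \<longleftrightarrow> x = 0"
proof -
  interpret vector_space scale by fact
  have "x + x = scale 2 x"
    by (metis one_add_one scale_left_distrib scale_one)
  then show ?thesis by simp
qed

text \<open>
  The sum runs over all ordered pairs \<open>(i, n - i)\<close>, so symmetrizing the associators doubles each of
  the three equations; the factor 2 can be cancelled in characteristic 0.
\<close>

lemma deformation_equations_iff_bracket:
  fixes scale :: "'k::field_char_0 \<Rightarrow> 'a::ab_group_add \<Rightarrow> 'a"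
  assumes "vector_space scale"
  shows "deformation_equations m1 m2 n \<longleftrightarrow>
    (\<Sum>i\<le>n. product_bracket scale (m1 i) (m2 i) (m1 (n - i)) (m2 (n - i))) = 0"
proof -
  have rev: "(\<Sum>i\<le>n. associator (q (n - i)) (p i) a b c) = associator_coeff q p n a b c"
    for p q :: "nat \<Rightarrow> 'a \<Rightarrow> 'a \<Rightarrow> 'a" and a b c
    unfolding associator_coeff_def
    by (rule sum.reindex_bij_witness[where i="\<lambda>i. n - i" and j="\<lambda>i. n - i"]) auto
  have "(\<Sum>i\<le>n. product_bracket scale (m1 i) (m2 i) (m1 (n - i)) (m2 (n - i))) =
    cochain_triple (\<lambda>a b c. associator_coeff m1 m1 n a b c + associator_coeff m1 m1 n a b c)
      (\<lambda>a b c. (associator_coeff m2 m1 n a b c + associator_coeff m1 m2 n a b c) +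
               (associator_coeff m2 m1 n a b c + associator_coeff m1 m2 n a b c))
      (\<lambda>a b c. associator_coeff m2 m2 n a b c + associator_coeff m2 m2 n a b c)"
    unfolding product_bracket_eq[OF assms] sum_cochain_triple sum.distrib rev
    by (simp add: add_ac flip: associator_coeff_def)
  then show ?thesis
    by (simp only: cochain_triple_eq_0_iff add_self_eq_0_iff[OF assms])
       (auto simp: deformation_equations_def)
qed

section \<open>Degree two cochains and coboundaries\<close>

text \<open>
  Cochains are zero off lists of the right length, and tuples are zero off their index range, so a
  2-cochain carries no information beyond its two bilinear maps.
\<close>

lemma compatible_cochains_2_iff:
  assumes "vector_space scale"
  shows "F \<in> compatible_cochains scale 2 \<longleftrightarrow>
    (\<exists>p1 p2. bilinear_on scale p1 \<and> bilinear_on scale p2 \<and> F = product_pair p1 p2)"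
proof -
  have cochain: "f \<in> cochains scale 2 \<longleftrightarrow> (\<exists>p. bilinear_on scale p \<and> f = product_cochain p)" for f
  proof
    assume f: "f \<in> cochains scale 2"
    have lin: "Vector_Spaces.linear scale scale (\<lambda>x. f [x, b])" "Vector_Spaces.linear scale scale (\<lambda>x. f [b, x])" for b
      using f[unfolded cochains_def, simplified, THEN conjunct1, rule_format, of "[b, b]" 0]
        f[unfolded cochains_def, simplified, THEN conjunct1, rule_format, of "[b, b]" 1] by simp_all
    then have "bilinear_on scale (\<lambda>a b. f [a, b])"
      by (simp add: bilinear_on_iff Vector_Spaces.linear_iff)
    moreover have "f = product_cochain (\<lambda>a b. f [a, b])"
    proof
      fix xs
      show "f xs = product_cochain (\<lambda>a b. f [a, b]) xs"
      proof (cases "length xs = 2")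
        case True
        then have "xs = [xs ! 0, xs ! 1]" by (auto simp: numeral_2_eq_2 length_Suc_conv)
        with True show ?thesis by (simp add: product_cochain_def)
      qed (use f in \<open>simp add: product_cochain_def cochains_def\<close>)
    qed
    ultimately show "\<exists>p. bilinear_on scale p \<and> f = product_cochain p" by blast
  next
    assume "\<exists>p. bilinear_on scale p \<and> f = product_cochain p"
    then show "f \<in> cochains scale 2"
      using assms by (auto simp: cochains_def product_cochain_def bilinear_on_iff Vector_Spaces.linear_iff less_2_cases_iff)
  qed
  have "{1..2::nat} = {1, 2}" by auto
  then have "F \<in> compatible_cochains scale 2 \<longleftrightarrow>
      F 1 \<in> cochains scale 2 \<and> F 2 \<in> cochains scale 2 \<and> (\<forall>i. i \<noteq> 1 \<and> i \<noteq> 2 \<longrightarrow> F i = 0)"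
    by (simp add: compatible_cochains_def)
  also have "\<dots> \<longleftrightarrow> (\<exists>p1 p2. bilinear_on scale p1 \<and> bilinear_on scale p2 \<and> F = product_pair p1 p2)"
    by (auto simp: cochain product_pair_def fun_eq_iff)
  finally show ?thesis .
qed

lemma coboundary_product_pair:
  assumes "vector_space scale"
  shows "coboundary scale mu1 mu2 2 (product_pair p1 p2) = - product_bracket scale mu1 mu2 p1 p2"
proof -
  interpret vector_space scale by fact
  show ?thesis
    by (simp add: coboundary_def scale_cochain_def product_bracket_def fun_eq_iff)
qed

lemma B3_eq:
  assumes "vector_space scale"
  shows "B3 scale mu1 mu2 = {- product_bracket scale mu1 mu2 p1 p2 | p1 p2. bilinear_on scale p1 \<and> bilinear_on scale p2}"
proof -
  have "compatible_cochains scale 2 =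
    {product_pair p1 p2 | p1 p2. bilinear_on scale p1 \<and> bilinear_on scale p2}"
    using compatible_cochains_2_iff[OF assms] by blast
  then show ?thesis
    unfolding B3_def coboundary_product_pair[OF assms, symmetric] by auto
qed

lemma B3_closed:
  assumes "vector_space scale" "bilinear_on scale mu1" "bilinear_on scale mu2"
  shows "0 \<in> B3 scale mu1 mu2"
    and "F \<in> B3 scale mu1 mu2 \<Longrightarrow> G \<in> B3 scale mu1 mu2 \<Longrightarrow> F + G \<in> B3 scale mu1 mu2"
    and "F \<in> B3 scale mu1 mu2 \<Longrightarrow> - F \<in> B3 scale mu1 mu2"
proof -
  interpret vector_space scale by fact
  note add = product_bracket_add[OF assms]
  have bil: "bilinear_on scale 0" "bilinear_on scale p \<Longrightarrow> bilinear_on scale (- p)"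
    "bilinear_on scale p \<Longrightarrow> bilinear_on scale q \<Longrightarrow> bilinear_on scale (p + q)" for p q
    by (auto simp: bilinear_on_iff scale_right_distrib)
  have zero: "product_bracket scale mu1 mu2 0 0 = 0"
    using add[of 0 0 0 0] by simp
  have uminus: "- product_bracket scale mu1 mu2 p1 p2 = product_bracket scale mu1 mu2 (- p1) (- p2)" for p1 p2
    using add[of p1 "- p1" p2 "- p2"] zero by (simp add: minus_unique)
  have mem: "- product_bracket scale mu1 mu2 p1 p2 \<in> B3 scale mu1 mu2"
    if "bilinear_on scale p1" "bilinear_on scale p2" for p1 p2
    using that unfolding B3_eq[OF assms(1)] by blast
  show "0 \<in> B3 scale mu1 mu2"
    using mem[OF bil(1) bil(1)] zero by simp
  show "F + G \<in> B3 scale mu1 mu2" if FG: "F \<in> B3 scale mu1 mu2" "G \<in> B3 scale mu1 mu2"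
  proof -
    from FG obtain p1 p2 q1 q2 where
      F: "bilinear_on scale p1" "bilinear_on scale p2" "F = - product_bracket scale mu1 mu2 p1 p2" and
      G: "bilinear_on scale q1" "bilinear_on scale q2" "G = - product_bracket scale mu1 mu2 q1 q2"
      unfolding B3_eq[OF assms(1)] by blast
    have "F + G = - product_bracket scale mu1 mu2 (p1 + q1) (p2 + q2)"
      by (simp add: F G add)
    then show ?thesis
      using mem[OF bil(3)[OF F(1) G(1)] bil(3)[OF F(2) G(2)]] by simp
  qed
  show "- F \<in> B3 scale mu1 mu2" if F: "F \<in> B3 scale mu1 mu2"
  proof -
    from F obtain p1 p2 where
      p: "bilinear_on scale p1" "bilinear_on scale p2" "F = - product_bracket scale mu1 mu2 p1 p2"
      unfolding B3_eq[OF assms(1)] by blast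
    then have "- F = - product_bracket scale mu1 mu2 (- p1) (- p2)"
      by (simp flip: uminus)
    then show ?thesis
      using mem[OF bil(2)[OF p(1)] bil(2)[OF p(2)]] by simp
  qed
qed

text \<open>
  The class is the translate of the group of coboundaries by \<open>F\<close>, and the neutral element of the
  quotient is that group itself.
\<close>

lemma H3_class_eq_one_iff:
  assumes "vector_space scale" "bilinear_on scale mu1" "bilinear_on scale mu2"
  shows "H3_class scale mu1 mu2 F = \<one>\<^bsub>H3 scale mu1 mu2\<^esub> \<longleftrightarrow> F \<in> B3 scale mu1 mu2"
proof -
  note closed = B3_closed[OF assms]
  have "H3_class scale mu1 mu2 F = (\<lambda>G. G + F) ` B3 scale mu1 mu2"
    by (auto simp: H3_class_def r_coset_def Z3_def)
  moreover have "\<one>\<^bsub>H3 scale mu1 mu2\<^esub> = B3 scale mu1 mu2"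
    by (simp add: H3_def FactGroup_def)
  moreover have "(\<lambda>G. G + F) ` B3 scale mu1 mu2 = B3 scale mu1 mu2" if F: "F \<in> B3 scale mu1 mu2"
  proof safe
    fix G assume "G \<in> B3 scale mu1 mu2"
    then have "G + - F \<in> B3 scale mu1 mu2" using closed F by blast
    then show "G \<in> (\<lambda>G. G + F) ` B3 scale mu1 mu2" by (force simp: image_iff)
  qed (use closed F in auto)
  moreover have "F \<in> (\<lambda>G. G + F) ` B3 scale mu1 mu2"
    using closed(1) by (force simp: image_iff)
  ultimately show ?thesis by metis
qed

section \<open>The obstruction\<close>

text \<open>
  The terms \<open>i = 0\<close> and \<open>i = N + 1\<close> agree by symmetry of the bracket, and the remaining ones make up
  \<open>-2\<close> times the obstruction. The double is written \<open>x + x\<close> because the scalars act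
  on \<open>A\<close> and not on the type of cochains.
\<close>

lemma sum_product_bracket_eq_obstruction:
  assumes "vector_space scale"
  shows "(\<Sum>i\<le>N + 1. product_bracket scale (m1 i) (m2 i) (m1 (N + 1 - i)) (m2 (N + 1 - i))) =
    (product_bracket scale (m1 0) (m2 0) (m1 (N + 1)) (m2 (N + 1)) - obstruction scale N m1 m2) +
    (product_bracket scale (m1 0) (m2 0) (m1 (N + 1)) (m2 (N + 1)) - obstruction scale N m1 m2)"
proof -
  interpret vector_space scale by fact
  let ?b = "\<lambda>i j. product_bracket scale (m1 i) (m2 i) (m1 j) (m2 j)"
  define S where "S = (\<Sum>(i, j)\<in>{(i, j). i \<ge> 1 \<and> j \<ge> 1 \<and> i + j = N + 1}. ?b i j)"
  have "S = (\<Sum>i\<in>{1..N}. ?b i (N + 1 - i))"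
    unfolding S_def
    by (rule sum.reindex_bij_witness[where i="\<lambda>i. (i, N + 1 - i)" and j=fst])
       (auto, metis add_diff_cancel_left')
  moreover have "{..N + 1} = insert 0 (insert (N + 1) {1..N})" by auto
  ultimately have sum: "(\<Sum>i\<le>N + 1. ?b i (N + 1 - i)) = ?b 0 (N + 1) + (?b (N + 1) 0 + S)"
    by simp
  have half: "- scale (1 / 2) x - scale (1 / 2) x = - x" for x
  proof -
    have "scale (1 / 2) x + scale (1 / 2) x = scale (1 / 2 + 1 / 2) x"
      by (rule scale_left_distrib[symmetric])
    also have "\<dots> = x" by simp
    finally have "- (scale (1 / 2) x + scale (1 / 2) x) = - x" by (rule arg_cong)
    then show ?thesis by simp
  qed
  have "obstruction scale N m1 m2 + obstruction scale N m1 m2 = - S"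
    unfolding obstruction_def product_bracket_def[symmetric] S_def[symmetric]
    by (simp add: scale_cochain_def fun_eq_iff half)
  then have S: "S = - (obstruction scale N m1 m2 + obstruction scale N m1 m2)" by simp
  show ?thesis
    unfolding sum S product_bracket_commute[OF assms, of "m1 (N + 1)"] by (simp add: algebra_simps)
qed

theorem theorem4p9:
  fixes scale :: "'k::field_char_0 \<Rightarrow> 'a::ab_group_add \<Rightarrow> 'a"
    and Basis :: "'a set"
    and mu1 mu2 :: "'a \<Rightarrow> 'a \<Rightarrow> 'a"
    and N :: nat
    and m1 m2 :: "nat \<Rightarrow> 'a \<Rightarrow> 'a \<Rightarrow> 'a"
  assumes "finite_dimensional_vector_space scale Basis"
    and "compatible_assoc_algebra ring_of_type_algebra (module_of_scale scale) mu1 mu2"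
    and "N \<ge> 1"
    and "order_deformation scale mu1 mu2 N m1 m2"
  shows "extensible scale mu1 mu2 N m1 m2 \<longleftrightarrow>
    H3_class scale mu1 mu2 (obstruction scale N m1 m2) = \<one>\<^bsub>H3 scale mu1 mu2\<^esub>"
proof -
  have vs: "vector_space scale"
    using assms(1) by (simp add: finite_dimensional_vector_space_def)
  have mu: "bilinear_on scale mu1" "bilinear_on scale mu2"
    using assms(2) by (simp_all add: compatible_assoc_algebra_def)
  let ?Ob = "obstruction scale N m1 m2"
  have def: "\<And>i. i \<le> N \<Longrightarrow> bilinear_on scale (m1 i)" "\<And>i. i \<le> N \<Longrightarrow> bilinear_on scale (m2 i)"
    "m1 0 = mu1" "m2 0 = mu2" "\<And>n. n \<le> N \<Longrightarrow> deformation_equations m1 m2 n"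
    using assms(4) by (simp_all add: order_deformation_iff[OF vs])
  have "order_deformation scale mu1 mu2 (N + 1) (m1(N + 1 := p1)) (m2(N + 1 := p2)) \<longleftrightarrow>
      ?Ob = product_bracket scale mu1 mu2 p1 p2"
    if p: "bilinear_on scale p1" "bilinear_on scale p2" for p1 p2
  proof -
    let ?m1 = "m1(N + 1 := p1)" and ?m2 = "m2(N + 1 := p2)"
    \<comment> \<open>Below degree \<open>N + 1\<close> the new coefficients do not occur, so the equations persist.\<close>
    have low: "deformation_equations ?m1 ?m2 n" if "n \<le> N" for n
    proof -
      have "n - i \<noteq> Suc N" "i \<le> n \<Longrightarrow> i \<noteq> Suc N" for i
        using that by auto
      then have "associator_coeff ?m1 ?m1 n = associator_coeff m1 m1 n"
        "associator_coeff ?m2 ?m2 n = associator_coeff m2 m2 n"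
        "associator_coeff ?m2 ?m1 n = associator_coeff m2 m1 n"
        "associator_coeff ?m1 ?m2 n = associator_coeff m1 m2 n"
        by (auto intro!: sum.cong simp: associator_coeff_def fun_eq_iff)
      then show ?thesis
        using def(5)[OF that] by (simp add: deformation_equations_def)
    qed
    \<comment> \<open>The obstruction involves only indices from 1 to \<open>N\<close>.\<close>
    have ob: "obstruction scale N ?m1 ?m2 = ?Ob"
      unfolding obstruction_def
      by (intro arg_cong[where f="scale_cochain scale _"] sum.cong) auto
    have double: "D + D = 0 \<longleftrightarrow> D = 0" for D :: "nat \<Rightarrow> 'a list \<Rightarrow> 'a"
      using add_self_eq_0_iff[OF vs] by (simp add: fun_eq_iff)
    have "order_deformation scale mu1 mu2 (N + 1) ?m1 ?m2 \<longleftrightarrow> deformation_equations ?m1 ?m2 (N + 1)"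
      using p def low by (auto simp: order_deformation_iff[OF vs] le_Suc_eq)
    also have "\<dots> \<longleftrightarrow> product_bracket scale mu1 mu2 p1 p2 - ?Ob = 0"
      unfolding deformation_equations_iff_bracket[OF vs] sum_product_bracket_eq_obstruction[OF vs] ob
      by (simp add: double def(3,4))
    finally show ?thesis by auto
  qed
  then have "extensible scale mu1 mu2 N m1 m2 \<longleftrightarrow>
      (\<exists>p1 p2. bilinear_on scale p1 \<and> bilinear_on scale p2 \<and> ?Ob = product_bracket scale mu1 mu2 p1 p2)"
    unfolding extensible_def by blast
  also have "\<dots> \<longleftrightarrow> - ?Ob \<in> B3 scale mu1 mu2"
    by (auto simp: B3_eq[OF vs])
  also have "\<dots> \<longleftrightarrow> ?Ob \<in> B3 scale mu1 mu2"
    using B3_closed(3)[OF vs mu] by (metis minus_minus)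
  also have "\<dots> \<longleftrightarrow> H3_class scale mu1 mu2 ?Ob = \<one>\<^bsub>H3 scale mu1 mu2\<^esub>"
    using H3_class_eq_one_iff[OF vs mu] by simp
  finally show ?thesis .
qed

end
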